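(* Let $p$ be a prime and let $R=\frac{r}{n}$ with integers $0<r<n$ and $p\nmid n$. Let $i_1<i_2<i_3<\cdots$ be an infinite increasing sequence of positive integers none of which is divisible by $p$. Then for each $j\ge1$ there exists an MDS code $\mathcal{C}_j$, over some finite field of characteristic $p$ (possibly depending on $j$), of length $i_j n$ and dimension $i_j r$. Each $\mathcal{C}_j$ has rate $R$ and minimum distance $d_j=i_j n-i_j r+1$, and $$\lim_{j\to\infty}\frac{d_j}{i_j n}=1-R.$$
   Context: A linear code of length $N$ and dimension $k$ over a field $\mathbb{F}$ is a $k$-dimensional linear subspace of $\mathbb{F}^N$; its rate is $\frac{k}{N}$. Its (minimum) distance is the minimum Hamming weight of a nonzero codeword. The code is MDS (maximum distance separable) if its minimum distance equals $N-k+1$. *)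

theory Defs
  imports Complex_Main "HOL-Computational_Algebra.Primes" "Jordan_Normal_Form.Missing_VectorSpace"
begin

definition characteristic :: "('a, 'm) ring_scheme \<Rightarrow> nat" where
  "characteristic F =
     (if \<exists>m::nat. m > 0 \<and> [m] \<cdot>\<^bsub>F\<^esub> \<one>\<^bsub>F\<^esub> = \<zero>\<^bsub>F\<^esub>
      then LEAST m::nat. m > 0 \<and> [m] \<cdot>\<^bsub>F\<^esub> \<one>\<^bsub>F\<^esub> = \<zero>\<^bsub>F\<^esub>
      else 0)"

(* A word of length N is an extensional function on the N coordinates 0, ..., N - 1. *)
abbreviation word_space :: "('a, 'm) ring_scheme \<Rightarrow> nat \<Rightarrow> ('a, nat \<Rightarrow> 'a) module" where
  "word_space F N \<equiv> ring.func_space F {..<N}"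

(* The locale predicate subspace includes that F is a field. *)
definition linear_code :: "('a, 'm) ring_scheme \<Rightarrow> nat \<Rightarrow> (nat \<Rightarrow> 'a) set \<Rightarrow> bool" where
  "linear_code F N C \<longleftrightarrow> subspace F C (word_space F N)"

definition code_dim :: "('a, 'm) ring_scheme \<Rightarrow> nat \<Rightarrow> (nat \<Rightarrow> 'a) set \<Rightarrow> nat" where
  "code_dim F N C = vectorspace.dim F ((word_space F N)\<lparr>carrier := C\<rparr>)"

definition code_rate :: "('a, 'm) ring_scheme \<Rightarrow> nat \<Rightarrow> (nat \<Rightarrow> 'a) set \<Rightarrow> real" where
  "code_rate F N C = real (code_dim F N C) / real N"

definition hamming_weight :: "('a, 'm) ring_scheme \<Rightarrow> nat \<Rightarrow> (nat \<Rightarrow> 'a) \<Rightarrow> nat" where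
  "hamming_weight F N v = card {k. k < N \<and> v k \<noteq> \<zero>\<^bsub>F\<^esub>}"

(* Weights are at most N, so Min ranges over a finite set; it is unspecified for the zero code. *)
definition min_distance :: "('a, 'm) ring_scheme \<Rightarrow> nat \<Rightarrow> (nat \<Rightarrow> 'a) set \<Rightarrow> nat" where
  "min_distance F N C = Min (hamming_weight F N ` (C - {\<zero>\<^bsub>word_space F N\<^esub>}))"

(* The dimension of a linear code is at most N, so the subtraction does not truncate. *)
definition mds_code :: "('a, 'm) ring_scheme \<Rightarrow> nat \<Rightarrow> (nat \<Rightarrow> 'a) set \<Rightarrow> bool" where
  "mds_code F N C \<longleftrightarrow> linear_code F N C \<and> min_distance F N C = N - code_dim F N C + 1"

end

theory Submission
  imports Defs "HOL-Algebra.Weak_Morphisms" "HOL-Algebra.Polynomial_Divisibility" "HOL-Number_Theory.Residues"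
begin

text \<open>Reed--Solomon codes: a nonzero polynomial of degree below \<open>k\<close> has fewer than \<open>k\<close> zeros, so
  evaluating all such polynomials at \<open>N\<close> distinct points of a field with at least \<open>N\<close> elements
  gives an MDS code of dimension \<open>k\<close>. A finite field of characteristic \<open>p\<close> that is as large as
  needed is reached from the integers modulo \<open>p\<close> by repeatedly adjoining a root of an irreducible
  polynomial of degree greater than 1; each extension is copied back to the natural numbers so that
  the type stays fixed along the iteration.\<close>

hide_const (open) Divisibility.prime

section \<open>Large finite fields of prescribed characteristic\<close>

text \<open>Homomorphisms between fields are injective, so a multiple of one vanishes in
  \<open>R\<close> exactly when its image vanishes in \<open>S\<close>. This carries the
  characteristic along every extension and every copy of a field.\<close>

lemma characteristic_ring_hom:
  assumes h: "h \<in> ring_hom R S" and R: "field R" and S: "field S"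
  shows "characteristic S = characteristic R"
proof -
  interpret R: field R by fact
  interpret S: field S by fact
  interpret hom: ring_hom_ring R S h
    using h by (intro ring_hom_ringI2 R.ring_axioms S.ring_axioms)
  have pow: "h ([m] \<cdot>\<^bsub>R\<^esub> \<one>\<^bsub>R\<^esub>) = [m] \<cdot>\<^bsub>S\<^esub> \<one>\<^bsub>S\<^esub>" for m :: nat
  proof (induction m)
    case (Suc m)
    thus ?case
      using R.add.nat_pow_closed[OF R.one_closed, of m]
      by (simp add: add_pow_def)
  qed (simp add: add_pow_def)
  have "inj_on h (carrier R)"
    by (rule non_trivial_field_hom_is_inj[OF h R S])
  hence "h x = \<zero>\<^bsub>S\<^esub> \<longleftrightarrow> x = \<zero>\<^bsub>R\<^esub>" if "x \<in> carrier R" for x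
    using that by (metis R.zero_closed hom.hom_zero inj_onD)
  hence "[m] \<cdot>\<^bsub>S\<^esub> \<one>\<^bsub>S\<^esub> = \<zero>\<^bsub>S\<^esub> \<longleftrightarrow> [m] \<cdot>\<^bsub>R\<^esub> \<one>\<^bsub>R\<^esub> = \<zero>\<^bsub>R\<^esub>" for m :: nat
    using R.add.nat_pow_closed[OF R.one_closed, of m, folded add_pow_def] pow[of m] by metis
  thus ?thesis
    by (simp only: characteristic_def)
qed

lemma characteristic_residue_ring:
  assumes "prime p"
  shows "characteristic (residue_ring (int p)) = p"
proof -
  interpret residues_prime p "residue_ring (int p)"
    by unfold_locales (use assms in auto)
  let ?R = "residue_ring (int p)"
  have "[m] \<cdot>\<^bsub>?R\<^esub> \<one>\<^bsub>?R\<^esub> = int m mod int p" for m :: nat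
    by (induction m)
      (simp_all add: add_pow_def res_zero_eq res_one_eq res_add_eq mod_add_right_eq add.commute)
  hence *: "[m] \<cdot>\<^bsub>?R\<^esub> \<one>\<^bsub>?R\<^esub> = \<zero>\<^bsub>?R\<^esub> \<longleftrightarrow> p dvd m" for m :: nat
    by (simp add: res_zero_eq mod_eq_0_iff_dvd)
  have "p > 0"
    using assms prime_gt_0_nat by blast
  thus ?thesis
    unfolding characteristic_def * by (auto intro!: Least_equality dvd_imp_le)
qed

lemma (in field) exists_irreducible_degree_gt_1:
  assumes fin: "finite (carrier R)"
  obtains q where "q \<in> carrier (poly_ring R)" "pirreducible (carrier R) q" "degree q > 1"
proof -
  \<comment> \<open>\<open>x\<^sup>2 - x\<close> takes the value \<open>0\<close> twice, so over a finite field it misses some \<open>c\<close>; then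
    \<open>x\<^sup>2 - x - c\<close> has no root and cannot have only linear factors.\<close>
  define g where "g x = x \<otimes> (x \<ominus> \<one>)" for x
  have "g ` carrier R \<subseteq> carrier R"
    by (auto simp: g_def)
  moreover have "\<not> inj_on g (carrier R)"
  proof
    assume "inj_on g (carrier R)"
    moreover have "g \<zero> = g \<one>"
      by (simp add: g_def minus_eq r_neg)
    ultimately show False
      using inj_onD zero_closed one_closed zero_not_one by metis
  qed
  ultimately obtain c where c: "c \<in> carrier R" "c \<notin> g ` carrier R"
    using fin by (metis eq_card_imp_inj_on subsetI subset_antisym)
  let ?p = "[\<one>, \<ominus> \<one>, \<ominus> c]"
  have p: "?p \<in> carrier (poly_ring R)"
    using c by (simp add: univ_poly_carrier[symmetric] polynomial_def)
  have "eval ?p x \<noteq> \<zero>" if x: "x \<in> carrier R" for x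
  proof
    have "eval ?p x = g x \<ominus> c"
      using x c by (simp add: g_def numeral_2_eq_2) algebra
    moreover assume "eval ?p x = \<zero>"
    ultimately have "g x = c"
      using x c by (simp add: g_def r_right_minus_eq)
    thus False
      using x c by blast
  qed
  hence "roots ?p = {#}"
    using roots_mem_iff_is_root[OF p] by (auto simp: is_root_def intro!: multiset_eqI simp flip: not_in_iff)
  \<comment> \<open>The root multiset is empty while the degree is 2. The contrapositive of
    \<open>trivial_factors_imp_splitted\<close> then yields an irreducible factor of degree greater
    than 1, which serves as the polynomial sought.\<close>
  hence "\<not> splitted ?p"
    by (simp add: splitted_def)
  thus ?thesis
    using trivial_factors_imp_splitted[OF p] that by (metis not_le)
qed

text \<open>The extension is the quotient by an irreducible \<open>q\<close> of degree greater than
  1. Its elements correspond to the remainders modulo \<open>q\<close>, a finite set that contains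
  all constants and also \<open>X\<close>.\<close>

lemma (in field) exists_larger_finite_field:
  assumes fin: "finite (carrier R)"
  obtains S :: "'a list set ring" and h where "field S" "finite (carrier S)" "h \<in> ring_hom R S"
    "card (carrier R) < card (carrier S)"
proof -
  obtain q where q: "q \<in> carrier (poly_ring R)" "pirreducible (carrier R) q" "degree q > 1"
    using exists_irreducible_degree_gt_1[OF fin] .
  let ?P = "(\<lambda>p. p pmod q) ` carrier (poly_ring R)"
  have P: "rupture_surj (carrier R) q ` ?P = carrier (Rupt (carrier R) q)"
    using rupture_carrier_as_pmod_image[OF carrier_is_subfield q(1)] .
  \<comment> \<open>A polynomial of degree below \<open>degree q\<close> is its own
    remainder.\<close>
  have in_P: "p \<in> ?P" if "p \<in> carrier (poly_ring R)" "degree p \<le> 1" for p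
    using pmod_const(2)[OF carrier_is_subfield that(1) q(1)] that q(3) by force
  have "?P \<subseteq> {p. set p \<subseteq> carrier R \<and> length p \<le> degree q}"
  proof
    fix r assume "r \<in> ?P"
    then obtain p where p: "p \<in> carrier (poly_ring R)" "r = p pmod q"
      by blast
    have "r \<in> carrier (poly_ring R)"
      using long_division_closed(2)[OF carrier_is_subfield p(1) q(1)] p(2) by simp
    hence "set r \<subseteq> carrier R"
      by (metis polynomial_incl univ_poly_carrier)
    \<comment> \<open>A polynomial is its coefficient list and \<open>degree\<close> is the length
      minus 1, so a degree below \<open>degree q\<close> means a length of at most
      \<open>degree q\<close>.\<close>
    moreover have "length r \<le> degree q"
      using pmod_degree[OF carrier_is_subfield p(1) q(1)] p(2) q(3) by fastforce
    ultimately show "r \<in> {p. set p \<subseteq> carrier R \<and> length p \<le> degree q}"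
      by simp
  qed
  hence finP: "finite ?P"
    using finite_lists_length_le[OF fin] finite_subset by blast
  have inj: "inj_on poly_of_const (carrier R)"
    by (auto simp: inj_on_def poly_of_const_def split: if_splits)
  have constants: "poly_of_const ` carrier R = {p \<in> carrier (poly_ring R). degree p = 0}"
    by (rule poly_of_const_over_carrier)
  have X: "X \<in> carrier (poly_ring R)"
    using var_closed(1)[OF carrier_is_subring] .
  have "X \<notin> poly_of_const ` carrier R"
    unfolding constants by (simp add: var_def)
  hence "card (insert X (poly_of_const ` carrier R)) = Suc (card (carrier R))"
    using fin by (simp add: card_image[OF inj])
  moreover have "insert X (poly_of_const ` carrier R) \<subseteq> ?P"
    using in_P[OF X] in_P unfolding constants by (auto simp: var_def)
  ultimately have "card (carrier R) < card ?P"
    using card_mono[OF finP] by (metis Suc_le_eq)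
  hence "card (carrier R) < card (carrier (Rupt (carrier R) q))"
    unfolding P[symmetric] by (simp add: card_image[OF rupture_surj_inj_on[OF carrier_is_subfield q(1)]])
  moreover have "field (Rupt (carrier R) q)"
    using rupture_is_field_iff_pirreducible[OF carrier_is_subfield q(1)] q(2) by blast
  moreover have "finite (carrier (Rupt (carrier R) q))"
    unfolding P[symmetric] using finP by (rule finite_imageI)
  \<comment> \<open>The base field embeds as the classes of the constant polynomials.\<close>
  moreover have "rupture_surj (carrier R) q \<circ> poly_of_const \<in> ring_hom R (Rupt (carrier R) q)"
    using rupture_surj_norm_is_hom[OF carrier_is_subring q(1)] by simp
  ultimately show ?thesis
    using that by blast
qed

text \<open>Relabelling the elements along an injection into the naturals makes that injection an
  isomorphism onto \<open>image_ring f R\<close>.\<close>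

lemma (in field) finite_field_transfer_nat:
  assumes fin: "finite (carrier R)"
  obtains S :: "nat ring" where "field S" "finite (carrier S)" "characteristic S = characteristic R"
    "card (carrier S) = card (carrier R)"
proof -
  obtain f :: "'a \<Rightarrow> nat" where f: "inj_on f (carrier R)"
    using finite_imp_inj_to_nat_seg[OF fin] by blast
  have "field (image_ring f R)"
    by (rule inj_imp_image_ring_is_field[OF f])
  moreover have "f \<in> ring_hom R (image_ring f R)"
    using inj_imp_image_ring_iso[OF f] by (simp add: ring_iso_def)
  hence "characteristic (image_ring f R) = characteristic R"
    by (rule characteristic_ring_hom[OF _ field_axioms calculation])
  ultimately show ?thesis
    using that[of "image_ring f R"] fin card_image[OF f] by (simp add: image_ring_carrier)
qed

text \<open>Each extension gains at least one element, so induction on the required size suffices,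
  starting from a copy of the integers modulo \<open>p\<close>.\<close>

lemma exists_large_finite_field:
  assumes "prime p"
  shows "\<exists>F :: nat ring. field F \<and> finite (carrier F) \<and> characteristic F = p \<and> N \<le> card (carrier F)"
proof (induction N)
  case 0
  interpret residues_prime p "residue_ring (int p)"
    by unfold_locales (use assms in auto)
  have "finite (carrier (residue_ring (int p)))"
    by (simp add: res_carrier_eq)
  then obtain S :: "nat ring" where "field S" "finite (carrier S)"
    "characteristic S = characteristic (residue_ring (int p))"
    using finite_field_transfer_nat by blast
  thus ?case
    using characteristic_residue_ring[OF assms] by auto
next
  case (Suc N)
  then obtain F :: "nat ring" where F: "field F" "finite (carrier F)" "characteristic F = p"
    "N \<le> card (carrier F)"
    by blast
  obtain S :: "nat list set ring" and h where S: "field S" "finite (carrier S)" "h \<in> ring_hom F S"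
    "card (carrier F) < card (carrier S)"
    using field.exists_larger_finite_field[OF F(1,2)] .
  obtain T :: "nat ring" where T: "field T" "finite (carrier T)"
    "characteristic T = characteristic S" "card (carrier T) = card (carrier S)"
    using field.finite_field_transfer_nat[OF S(1,2)] .
  have "characteristic S = p"
    using characteristic_ring_hom[OF S(3) F(1) S(1)] F(3) by simp
  thus ?case
    using T F(4) S(4) by (intro exI[of _ T]) simp
qed


section \<open>Linear codes over finite fields\<close>

text \<open>With respect to a finite basis, vectors correspond bijectively to coefficient functions
  on the basis; a finite space has such a basis because it generates itself.\<close>

lemma (in vectorspace) card_carrier_eq_power_dim:
  assumes finK: "finite (carrier K)" and finV: "finite (carrier V)"
  shows "card (carrier V) = card (carrier K) ^ dim"
proof -
  have "gen_set (carrier V)"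
    using in_own_span[of "carrier V"] span_is_subset2[of "carrier V"] by blast
  hence "fin_dim"
    unfolding fin_dim_def using finV by blast
  then obtain B where B: "finite B" "basis B"
    using finite_basis_exists by blast
  hence BV: "B \<subseteq> carrier V"
    by (simp add: basis_def)
  have unique: "\<exists>!a. a \<in> B \<rightarrow>\<^sub>E carrier K \<and> lincomb a B = v" if "v \<in> carrier V" for v
    using basis_criterion[OF B(1) BV] B(2) that by blast
  have closed: "lincomb a B \<in> carrier V" if "a \<in> B \<rightarrow>\<^sub>E carrier K" for a
    using that BV by (intro lincomb_closed) auto
  have "bij_betw (\<lambda>a. lincomb a B) (B \<rightarrow>\<^sub>E carrier K) (carrier V)"
  proof (rule bij_betw_imageI)
    show "inj_on (\<lambda>a. lincomb a B) (B \<rightarrow>\<^sub>E carrier K)"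
      using unique closed by (intro inj_onI) blast
    show "(\<lambda>a. lincomb a B) ` (B \<rightarrow>\<^sub>E carrier K) = carrier V"
      using unique closed by blast
  qed
  hence "card (carrier V) = card (B \<rightarrow>\<^sub>E carrier K)"
    by (metis bij_betw_same_card)
  also have "\<dots> = card (carrier K) ^ card B"
    using B(1) by (simp add: card_PiE)
  finally show ?thesis
    using dim_basis[OF B] by simp
qed

lemma (in field) vectorspace_func_space: "vectorspace R (func_space S)"
  by (intro vectorspace.intro func_space_is_module field_axioms)

text \<open>Lets dimensions be handled by counting codewords, both in the pigeonhole argument and in
  finding the dimension of a Reed--Solomon code.\<close>

lemma (in field) linear_code_card:
  assumes fin: "finite (carrier R)" and C: "linear_code R N C"
  shows "card C = card (carrier R) ^ code_dim R N C"
proof -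
  interpret W: vectorspace R "func_space {..<N}"
    by (rule vectorspace_func_space)
  interpret C: vectorspace R "(func_space {..<N})\<lparr>carrier := C\<rparr>"
    using C unfolding linear_code_def by (rule W.subspace_is_vs)
  have "C \<subseteq> {..<N} \<rightarrow>\<^sub>E carrier R"
    using C unfolding linear_code_def subspace_def submodule_def by (simp add: func_space_def)
  hence "finite C"
    using fin by (meson finite_PiE finite_lessThan finite_subset)
  thus ?thesis
    using C.card_carrier_eq_power_dim[OF fin] by (simp add: code_dim_def)
qed

lemma (in field) linear_code_diff:
  assumes C: "linear_code R N C" and v: "v \<in> C" and w: "w \<in> C"
  shows "(\<lambda>t\<in>{..<N}. v t \<ominus> w t) \<in> C"
proof -
  have sub: "submodule R C (func_space {..<N})"
    using C by (simp add: linear_code_def subspace_def)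
  have carr: "u t \<in> carrier R" if "u \<in> C" "t < N" for u t
    using submodule.subset[OF sub] that by (auto simp: func_space_def)
  have "v \<oplus>\<^bsub>func_space {..<N}\<^esub> ((\<ominus> \<one>) \<odot>\<^bsub>func_space {..<N}\<^esub> w) \<in> C"
    using v w by (intro submodule.m_closed[OF sub] submodule.smult_closed[OF sub]) auto
  also have "v \<oplus>\<^bsub>func_space {..<N}\<^esub> ((\<ominus> \<one>) \<odot>\<^bsub>func_space {..<N}\<^esub> w) = (\<lambda>t\<in>{..<N}. v t \<ominus> w t)"
    using carr[OF v] carr[OF w] by (auto simp: func_space_def minus_eq l_minus intro!: restrict_ext)
  finally show ?thesis .
qed

lemma (in field) card_carrier_gt_1:
  assumes fin: "finite (carrier R)"
  shows "1 < card (carrier R)"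
proof -
  have "card {\<zero>, \<one>} \<le> card (carrier R)"
    by (intro card_mono fin) auto
  thus ?thesis
    by simp
qed

text \<open>Gives the upper half of the distance formula without exhibiting a minimum weight
  codeword explicitly.\<close>

lemma (in field) singleton_bound:
  assumes fin: "finite (carrier R)" and C: "linear_code R N C" and pos: "0 < code_dim R N C"
  shows "\<exists>u \<in> C - {\<zero>\<^bsub>word_space R N\<^esub>}. hamming_weight R N u \<le> N - (code_dim R N C - 1)"
proof -
  define k where "k = code_dim R N C"
  \<comment> \<open>Pigeonhole: two codewords agree in the first \<open>k - 1\<close> coordinates.\<close>
  define f where "f v = restrict v ({..<N} \<inter> {..<k - 1})" for v :: "nat \<Rightarrow> 'a"
  have CN: "C \<subseteq> {..<N} \<rightarrow>\<^sub>E carrier R"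
    using C unfolding linear_code_def subspace_def submodule_def by (simp add: func_space_def)
  have q: "1 < card (carrier R)"
    by (rule card_carrier_gt_1[OF fin])
  have "f ` C \<subseteq> ({..<N} \<inter> {..<k - 1}) \<rightarrow>\<^sub>E carrier R"
    using CN by (fastforce simp: f_def image_subset_iff)
  hence "card (f ` C) \<le> card (({..<N} \<inter> {..<k - 1}) \<rightarrow>\<^sub>E carrier R)"
    using fin by (intro card_mono finite_PiE) auto
  also have "\<dots> = card (carrier R) ^ card ({..<N} \<inter> {..<k - 1})"
    by (simp add: card_PiE)
  \<comment> \<open>The set of kept coordinates is cut off at \<open>N\<close>, so its size is only
    bounded by \<open>k - 1\<close>, without a comparison of \<open>k\<close> with
    \<open>N\<close>.\<close>
  also have "\<dots> \<le> card (carrier R) ^ (k - 1)"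
    using q card_mono[of "{..<k - 1}" "{..<N} \<inter> {..<k - 1}"] by (intro power_increasing) auto
  also have "\<dots> < card (carrier R) ^ k"
    using q pos by (intro power_strict_increasing) (auto simp: k_def)
  also have "\<dots> = card C"
    using linear_code_card[OF fin C] by (simp add: k_def)
  finally have "\<not> inj_on f C"
    using card_image[of f C] by auto
  then obtain v w where vw: "v \<in> C" "w \<in> C" "f v = f w" "v \<noteq> w"
    by (auto simp: inj_on_def)
  \<comment> \<open>The difference of the colliding codewords vanishes exactly where they agree,
    hence on the first \<open>k - 1\<close> coordinates.\<close>
  define u where "u = (\<lambda>t\<in>{..<N}. v t \<ominus> w t)"
  have carr: "v t \<in> carrier R" "w t \<in> carrier R" if "t < N" for t
    using vw CN that by auto
  have u0: "u t = \<zero> \<longleftrightarrow> v t = w t" if "t < N" for t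
    using that carr[OF that] by (simp add: u_def)
  \<comment> \<open>Words are extensional, so agreement on all \<open>N\<close> coordinates is
    equality of functions.\<close>
  have "v = w" if "\<forall>t<N. v t = w t"
    using vw(1,2) CN that by (intro PiE_ext[of v "{..<N}" "\<lambda>_. carrier R" w]) auto
  then obtain t where "t < N" "v t \<noteq> w t"
    using vw(4) by blast
  hence "u t \<noteq> \<zero>\<^bsub>word_space R N\<^esub> t"
    using u0[of t] by (simp add: func_space_def)
  hence "u \<noteq> \<zero>\<^bsub>word_space R N\<^esub>"
    by auto
  moreover have "u \<in> C"
    unfolding u_def by (rule linear_code_diff[OF C vw(1,2)])
  moreover have "hamming_weight R N u \<le> N - (k - 1)"
  proof -
    have "v t = w t" if "t < N" "t < k - 1" for t
      using fun_cong[OF vw(3), of t] that by (simp add: f_def)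
    hence "{t. t < N \<and> u t \<noteq> \<zero>} \<subseteq> {k - 1..<N}"
      using u0 by (auto simp: not_less[symmetric])
    thus ?thesis
      unfolding hamming_weight_def using card_mono[OF finite_atLeastLessThan] by fastforce
  qed
  ultimately show ?thesis
    unfolding k_def by blast
qed

section \<open>Reed--Solomon codes\<close>

text \<open>Dropping leading zeros keeps the values and leaves a nonzero polynomial, whose number of
  roots is at most its degree, which is below the length of the list.\<close>

lemma (in field) finite_zeros_card_less_length:
  assumes as: "set as \<subseteq> carrier R" and nz: "\<not> set as \<subseteq> {\<zero>}"
  shows "finite {x \<in> carrier R. eval as x = \<zero>} \<and> card {x \<in> carrier R. eval as x = \<zero>} < length as"
proof -
  let ?p = "normalize as"
  have "normalize bs = [] \<Longrightarrow> set bs \<subseteq> {\<zero>}" for bs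
    by (induction bs) (auto split: if_splits)
  hence ne: "?p \<noteq> []"
    using nz by blast
  have p: "?p \<in> carrier (poly_ring R)"
    using normalize_gives_polynomial[OF as] by (simp add: univ_poly_carrier)
  have eq: "{x \<in> carrier R. eval as x = \<zero>} = set_mset (roots ?p)"
    using roots_mem_iff_is_root[OF p] ne eval_normalize[OF as] by (auto simp: is_root_def)
  have "card (set_mset (roots ?p)) = (\<Sum>x\<in>set_mset (roots ?p). 1)"
    by simp
  \<comment> \<open>Every root has multiplicity at least 1.\<close>
  also have "\<dots> \<le> (\<Sum>x\<in>set_mset (roots ?p). count (roots ?p) x)"
    by (intro sum_mono) (simp add: Suc_le_eq)
  also have "\<dots> = size (roots ?p)"
    by (simp add: size_multiset_overloaded_eq)
  also have "\<dots> \<le> degree ?p"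
    by (rule size_roots_le_degree[OF p])
  also have "\<dots> < length as"
    using ne normalize_length_le[of as] by (cases ?p) auto
  finally show ?thesis
    unfolding eq by simp
qed

text \<open>Coefficientwise addition is used instead of \<open>poly_add\<close> because the latter
  normalizes, whereas messages must keep their length.\<close>

lemma (in ring) eval_map2_add:
  assumes "set as \<subseteq> carrier R" "set bs \<subseteq> carrier R" "length as = length bs" "x \<in> carrier R"
  shows "eval (map2 (\<oplus>) as bs) x = eval as x \<oplus> eval bs x"
proof -
  have "set (map2 (\<oplus>) as bs) \<subseteq> carrier R"
    using assms(1,2) by (auto simp: subset_iff elim!: in_set_zipE)
  thus ?thesis
    using eval_poly_add_aux[OF assms] eval_normalize assms by simp
qed

lemma (in cring) eval_map_mult:
  assumes "set as \<subseteq> carrier R" "c \<in> carrier R" "x \<in> carrier R"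
  shows "eval (map ((\<otimes>) c) as) x = c \<otimes> eval as x"
  using assms by (induction as) (auto simp: eval_in_carrier r_distr m_assoc)

text \<open>The coefficient lists are not normalized (leading zeros are allowed), so that exactly
  the polynomials of degree below \<open>k\<close> are evaluated and messages can be counted as lists.\<close>
definition (in ring) reed_solomon :: "(nat \<Rightarrow> 'a) \<Rightarrow> nat \<Rightarrow> nat \<Rightarrow> (nat \<Rightarrow> 'a) set" where
  "reed_solomon x N k =
     (\<lambda>as. \<lambda>t\<in>{..<N}. eval as (x t)) ` {as. set as \<subseteq> carrier R \<and> length as = k}"

context field
begin

context
  fixes x :: "nat \<Rightarrow> 'a" and N :: nat
  assumes points: "x ` {..<N} \<subseteq> carrier R" "inj_on x {..<N}"
begin

lemma linear_code_reed_solomon: "linear_code R N (reed_solomon x N k)"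
proof -
  have x: "x t \<in> carrier R" if "t < N" for t
    using points that by auto
  have "submodule R (reed_solomon x N k) (func_space {..<N})"
  proof (rule submodule.intro)
    show "module R (func_space {..<N})"
      by (rule func_space_is_module)
    show "reed_solomon x N k \<subseteq> carrier (func_space {..<N})"
      using x by (simp add: reed_solomon_def func_space_def image_subset_iff eval_in_carrier)
    \<comment> \<open>The zero word is the encoding of the all-zero list of length \<open>k\<close>,
      padded with nothing but leading zeros.\<close>
    have "eval (replicate k \<zero>) y = \<zero>" if "y \<in> carrier R" for y
      using eval_replicate[of "[]" y k] that by simp
    thus "\<zero>\<^bsub>func_space {..<N}\<^esub> \<in> reed_solomon x N k"
      unfolding reed_solomon_def using x
      by (intro image_eqI[of _ _ "replicate k \<zero>"]) (auto simp: func_space_def intro!: restrict_ext)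
  next
    fix v w assume "v \<in> reed_solomon x N k" "w \<in> reed_solomon x N k"
    then obtain as bs where as: "set as \<subseteq> carrier R" "length as = k" "v = (\<lambda>t\<in>{..<N}. eval as (x t))"
      and bs: "set bs \<subseteq> carrier R" "length bs = k" "w = (\<lambda>t\<in>{..<N}. eval bs (x t))"
      by (auto simp: reed_solomon_def)
    have "v \<oplus>\<^bsub>func_space {..<N}\<^esub> w = (\<lambda>t\<in>{..<N}. eval (map2 (\<oplus>) as bs) (x t))"
      using as bs x by (auto simp: func_space_def eval_map2_add intro!: restrict_ext)
    moreover have "set (map2 (\<oplus>) as bs) \<subseteq> carrier R"
      using as(1) bs(1) by (auto simp: subset_iff elim!: in_set_zipE)
    ultimately show "v \<oplus>\<^bsub>func_space {..<N}\<^esub> w \<in> reed_solomon x N k"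
      unfolding reed_solomon_def using as(2) bs(2)
      by (intro image_eqI[of _ _ "map2 (\<oplus>) as bs"]) simp_all
  next
    fix c v assume c: "c \<in> carrier R" and "v \<in> reed_solomon x N k"
    then obtain as where as: "set as \<subseteq> carrier R" "length as = k" "v = (\<lambda>t\<in>{..<N}. eval as (x t))"
      by (auto simp: reed_solomon_def)
    have "c \<odot>\<^bsub>func_space {..<N}\<^esub> v = (\<lambda>t\<in>{..<N}. eval (map ((\<otimes>) c) as) (x t))"
      using as c x by (auto simp: func_space_def eval_map_mult intro!: restrict_ext)
    thus "c \<odot>\<^bsub>func_space {..<N}\<^esub> v \<in> reed_solomon x N k"
      unfolding reed_solomon_def using as c
      by (intro image_eqI[of _ _ "map ((\<otimes>) c) as"]) auto
  qed
  thus ?thesis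
    unfolding linear_code_def by (intro subspace.intro vectorspace_func_space)
qed

text \<open>The evaluation points are distinct, so zero positions inject into the zeros of the
  polynomial in the field.\<close>

lemma card_zero_positions_less:
  assumes as: "set as \<subseteq> carrier R" and nz: "\<not> set as \<subseteq> {\<zero>}"
  shows "card {t. t < N \<and> eval as (x t) = \<zero>} < length as"
proof -
  have "card {t. t < N \<and> eval as (x t) = \<zero>} = card (x ` {t. t < N \<and> eval as (x t) = \<zero>})"
    using points(2) by (intro card_image[symmetric]) (auto simp: inj_on_def)
  also have "\<dots> \<le> card {y \<in> carrier R. eval as y = \<zero>}"
    using points(1) finite_zeros_card_less_length[OF as nz] by (intro card_mono) auto
  also have "\<dots> < length as"
    using finite_zeros_card_less_length[OF as nz] by blast
  finally show ?thesis .
qed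

text \<open>If two messages have the same codeword, their difference vanishes at \<open>N\<close>
  points; as \<open>N\<close> is at least \<open>k\<close>, a nonzero list of length
  \<open>k\<close> cannot do this.\<close>

lemma inj_on_reed_solomon_encoding:
  assumes "k \<le> N"
  shows "inj_on (\<lambda>as. \<lambda>t\<in>{..<N}. eval as (x t)) {as. set as \<subseteq> carrier R \<and> length as = k}"
proof (rule inj_onI)
  fix as bs
  assume "as \<in> {as. set as \<subseteq> carrier R \<and> length as = k}" "bs \<in> {as. set as \<subseteq> carrier R \<and> length as = k}"
  hence as: "set as \<subseteq> carrier R" "length as = k" and bs: "set bs \<subseteq> carrier R" "length bs = k"
    by auto
  assume eq: "(\<lambda>t\<in>{..<N}. eval as (x t)) = (\<lambda>t\<in>{..<N}. eval bs (x t))"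
  \<comment> \<open>This is the difference of the two messages, formed without changing the length
    \<open>k\<close>.\<close>
  define cs where "cs = map2 (\<oplus>) as (map ((\<otimes>) (\<ominus> \<one>)) bs)"
  have neg: "set (map ((\<otimes>) (\<ominus> \<one>)) bs) \<subseteq> carrier R"
    using bs by auto
  have cs: "set cs \<subseteq> carrier R" "length cs = k"
    using as bs neg unfolding cs_def by (auto simp: subset_iff elim!: in_set_zipE)
  have "eval cs (x t) = \<zero>" if "t < N" for t
  proof -
    have xt: "x t \<in> carrier R"
      using points that by auto
    have "eval cs (x t) = eval as (x t) \<oplus> (\<ominus> \<one>) \<otimes> eval bs (x t)"
      unfolding cs_def using as bs neg xt by (simp add: eval_map2_add eval_map_mult)
    moreover have "eval as (x t) = eval bs (x t)"
      using fun_cong[OF eq, of t] that by simp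
    ultimately show ?thesis
      using eval_in_carrier[OF bs(1) xt] by (simp add: l_minus r_neg)
  qed
  hence "{t. t < N \<and> eval cs (x t) = \<zero>} = {..<N}"
    by auto
  hence zero: "set cs \<subseteq> {\<zero>}"
    using card_zero_positions_less[OF cs(1)] cs(2) assms by fastforce
  show "as = bs"
  proof (rule nth_equalityI)
    fix i assume "i < length as"
    hence i: "i < k" "as ! i \<in> carrier R" "bs ! i \<in> carrier R"
      using as bs by (auto simp: subset_iff)
    have "cs ! i = \<zero>"
      using zero cs(2) i(1) nth_mem by fastforce
    hence "as ! i \<ominus> bs ! i = \<zero>"
      using i as(2) bs(2) by (simp add: cs_def minus_eq l_minus)
    thus "as ! i = bs ! i"
      using i by simp
  qed (use as bs in simp)
qed

text \<open>By injectivity the code has as many words as there are messages; comparing powers of the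
  field size, which exceeds 1, gives the exponent.\<close>

lemma code_dim_reed_solomon:
  assumes fin: "finite (carrier R)" and k: "k \<le> N"
  shows "code_dim R N (reed_solomon x N k) = k"
proof -
  have q: "1 < card (carrier R)"
    by (rule card_carrier_gt_1[OF fin])
  have "card (carrier R) ^ code_dim R N (reed_solomon x N k) = card (reed_solomon x N k)"
    using linear_code_card[OF fin linear_code_reed_solomon] by simp
  also have "\<dots> = card (carrier R) ^ k"
    unfolding reed_solomon_def
    by (simp add: card_image[OF inj_on_reed_solomon_encoding[OF k]] card_lists_length_eq[OF fin])
  finally show ?thesis
    using q by (simp add: power_inject_exp)
qed

text \<open>A nonzero codeword has at most \<open>k - 1\<close> zeros, which bounds all weights from
  below; the Singleton bound supplies a codeword that attains this value.\<close>

lemma min_distance_reed_solomon: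
  assumes fin: "finite (carrier R)" and k: "0 < k" "k \<le> N"
  shows "min_distance R N (reed_solomon x N k) = N - k + 1"
proof -
  let ?C = "reed_solomon x N k"
  let ?W = "hamming_weight R N ` (?C - {\<zero>\<^bsub>word_space R N\<^esub>})"
  have lower: "N - k + 1 \<le> hamming_weight R N u" if mem: "u \<in> ?C - {\<zero>\<^bsub>word_space R N\<^esub>}" for u
  proof -
    obtain as where as: "set as \<subseteq> carrier R" "length as = k" "u = (\<lambda>t\<in>{..<N}. eval as (x t))"
      using mem unfolding reed_solomon_def by blast
    have "\<not> set as \<subseteq> {\<zero>}"
    proof
      assume "set as \<subseteq> {\<zero>}"
      hence "as = replicate k \<zero>"
        using as(2) by (metis replicate_eqI singletonD subsetD)
      hence "eval as y = \<zero>" if "y \<in> carrier R" for y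
        using eval_replicate[of "[]" y k] that by simp
      hence "u = \<zero>\<^bsub>word_space R N\<^esub>"
        using as(3) points(1) by (auto simp: func_space_def intro!: restrict_ext)
      thus False
        using mem by simp
    qed
    hence "card {t. t < N \<and> u t = \<zero>} < k"
      using card_zero_positions_less[OF as(1)] as(2,3) by (simp cong: conj_cong)
    moreover have "{t. t < N \<and> u t \<noteq> \<zero>} = {..<N} - {t. t < N \<and> u t = \<zero>}"
      by auto
    hence "hamming_weight R N u = N - card {t. t < N \<and> u t = \<zero>}"
      unfolding hamming_weight_def by (simp add: card_Diff_subset subset_iff)
    ultimately show ?thesis
      using k by linarith
  qed
  have dim: "code_dim R N ?C = k"
    by (rule code_dim_reed_solomon[OF fin k(2)])
  obtain u where u: "u \<in> ?C - {\<zero>\<^bsub>word_space R N\<^esub>}" "hamming_weight R N u \<le> N - (k - 1)"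
    using singleton_bound[OF fin linear_code_reed_solomon, of k] dim k(1) by auto
  have "hamming_weight R N u = N - k + 1"
    using lower[OF u(1)] u(2) k by linarith
  \<comment> \<open>Bounded weights make the set of weights finite, as required for
    \<open>Min\<close>.\<close>
  moreover have "hamming_weight R N v \<le> N" for v
    using card_mono[of "{..<N}" "{t. t < N \<and> v t \<noteq> \<zero>}"] by (auto simp: hamming_weight_def)
  hence "finite ?W"
    by (meson finite_atMost finite_subset image_subsetI atMost_iff)
  ultimately show ?thesis
    unfolding min_distance_def using lower u(1) by (intro Min_eqI) (auto intro: rev_image_eqI)
qed

end

lemma exists_mds_code:
  assumes fin: "finite (carrier R)" and N: "N \<le> card (carrier R)" and k: "0 < k" "k \<le> N"
  shows "\<exists>C. mds_code R N C \<and> code_dim R N C = k"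
proof -
  obtain A where A: "A \<subseteq> carrier R" "card A = N" "finite A"
    using obtain_subset_with_card_n[OF N] by blast
  then obtain x where "bij_betw x {..<N} A"
    using ex_bij_betw_nat_finite[OF A(3)] A(2) by (auto simp: atLeast0LessThan)
  hence x: "x ` {..<N} \<subseteq> carrier R" "inj_on x {..<N}"
    using A by (auto simp: bij_betw_def)
  have "code_dim R N (reed_solomon x N k) = k"
    by (rule code_dim_reed_solomon[OF x fin k(2)])
  moreover have "mds_code R N (reed_solomon x N k)"
    unfolding mds_code_def calculation
    using linear_code_reed_solomon[OF x] min_distance_reed_solomon[OF x fin k] by simp
  ultimately show ?thesis
    by blast
qed

end



section \<open>The family of codes and the limit of the relative distance\<close>

theorem mainTheorem5:
  fixes p r n :: nat and R :: real and i :: "nat \<Rightarrow> nat"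
  assumes "prime p"
    and "0 < r" and "r < n" and "\<not> p dvd n"
    and "R = real r / real n"
    and "strict_mono_on {1..} i"
    and "\<And>j. 1 \<le> j \<Longrightarrow> 0 < i j \<and> \<not> p dvd i j"
  shows "\<exists>(F :: nat \<Rightarrow> nat ring) (C :: nat \<Rightarrow> (nat \<Rightarrow> nat) set).
    (\<forall>j\<ge>1. field (F j) \<and> finite (carrier (F j)) \<and> characteristic (F j) = p
        \<and> mds_code (F j) (i j * n) (C j)
        \<and> code_dim (F j) (i j * n) (C j) = i j * r
        \<and> code_rate (F j) (i j * n) (C j) = R
        \<and> min_distance (F j) (i j * n) (C j) = i j * n - i j * r + 1)
    \<and> (\<lambda>j. real (min_distance (F j) (i j * n) (C j)) / real (i j * n)) \<longlonglongrightarrow> 1 - R"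
proof -
  note p = assms(1) and r = assms(2) and rn = assms(3) and R = assms(5) and mono = assms(6)
  have ipos: "0 < i j" if "1 \<le> j" for j
    using assms(7) that by blast
  \<comment> \<open>The field must offer one evaluation point for each of the \<open>i j * n\<close>
    coordinates.\<close>
  have "\<forall>j. \<exists>F :: nat ring. field F \<and> finite (carrier F) \<and> characteristic F = p \<and> i j * n \<le> card (carrier F)"
    using exists_large_finite_field[OF p] by blast
  from choice[OF this] obtain F :: "nat \<Rightarrow> nat ring" where F: "field (F j)" "finite (carrier (F j))"
    "characteristic (F j) = p" "i j * n \<le> card (carrier (F j))" for j
    by blast
  \<comment> \<open>The premise sits inside the existential so that \<open>choice\<close> applies to
    all indices; at index 0 the value of \<open>i\<close> is unconstrained and \<open>C\<close> is
    arbitrary.\<close>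
  have "\<exists>C. 1 \<le> j \<longrightarrow> mds_code (F j) (i j * n) C \<and> code_dim (F j) (i j * n) C = i j * r" for j
    using field.exists_mds_code[OF F(1,2,4), of "i j * r" j] ipos[of j] r rn by auto
  hence "\<forall>j. \<exists>C. 1 \<le> j \<longrightarrow> mds_code (F j) (i j * n) C \<and> code_dim (F j) (i j * n) C = i j * r"
    by blast
  from choice[OF this] obtain C
    where C: "mds_code (F j) (i j * n) (C j)" "code_dim (F j) (i j * n) (C j) = i j * r"
    if "1 \<le> j" for j
    by blast
  have rate: "code_rate (F j) (i j * n) (C j) = R" if "1 \<le> j" for j
    using C(2)[OF that] ipos[OF that] by (simp add: code_rate_def R)
  have dist: "min_distance (F j) (i j * n) (C j) = i j * n - i j * r + 1" if "1 \<le> j" for j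
    using C[OF that] by (simp add: mds_code_def)
  \<comment> \<open>Strict growth from a positive start sends the code lengths to infinity, so the
    term \<open>1 / real (i j * n)\<close> below tends to 0.\<close>
  have grow: "j \<le> i j" if "1 \<le> j" for j
    using that
  proof (induction j rule: dec_induct)
    case base
    show ?case
      using ipos[of 1] by simp
  next
    case (step j)
    have "i j < i (Suc j)"
      using step.hyps by (intro strict_mono_onD[OF mono]) auto
    thus ?case
      using step.IH by simp
  qed
  have "filterlim (\<lambda>j. real (i j * n)) at_top sequentially"
  proof (rule filterlim_at_top_mono[OF filterlim_real_sequentially])
    have "j \<le> i j * n" if "1 \<le> j" for j
    proof -
      have "i j \<le> i j * n"
        using rn by simp
      with grow[OF that] show ?thesis
        by (rule le_trans)
    qed
    thus "eventually (\<lambda>j. real j \<le> real (i j * n)) sequentially"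
      by (intro eventually_sequentiallyI[of 1]) (simp only: of_nat_le_iff)
  qed
  hence "(\<lambda>j. 1 - R + 1 / real (i j * n)) \<longlonglongrightarrow> 1 - R + 0"
    by (intro tendsto_add tendsto_const tendsto_divide_0[OF tendsto_const] filterlim_at_top_imp_at_infinity)
  hence lim: "(\<lambda>j. 1 - R + 1 / real (i j * n)) \<longlonglongrightarrow> 1 - R"
    by (simp only: add_0_right)
  \<comment> \<open>The distance is \<open>i j * (n - r) + 1\<close>; divided by the length, its
    first summand gives exactly \<open>1 - R\<close>.\<close>
  have eq: "1 - R + 1 / real (i j * n)
      = real (min_distance (F j) (i j * n) (C j)) / real (i j * n)" if "1 \<le> j" for j
  proof -
    have "real (i j * n - i j * r + 1) = real (i j) * (real n - real r) + 1"
      using rn by (simp add: of_nat_diff algebra_simps)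
    thus ?thesis
      unfolding dist[OF that] R using ipos[OF that] rn by (simp add: field_simps)
  qed
  have "(\<lambda>j. real (min_distance (F j) (i j * n) (C j)) / real (i j * n)) \<longlonglongrightarrow> 1 - R"
    by (rule Lim_transform_eventually[OF lim], rule eventually_sequentiallyI[of 1], rule eq)
  thus ?thesis
    using F C rate dist by (intro exI[of _ F] exI[of _ C]) simp
qed

end
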